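(* Let $f\in C^1(\mathbb{R}^+)\cap L^\infty(\mathbb{R}^+)$ with $f(0)=0$. (i) For every $\delta$ with $0<\delta<1$ there are constants $C_1,C_2>0$ (independent of $f$) such that $$\int_0^\infty\frac{f(x)^2}{x^{2+\delta}}\,dx\ \ge\ C_1\left(\int_0^\infty\frac{|f(x)|}{x^{1+\delta}}\,dx\right)^2-C_2\left(1+\|f\|_{L^\infty}^2\right).$$ (ii) For every $0<\alpha<1/4$, every $0<\delta<1-4\alpha$ and every $\epsilon>0$ there is a constant $C_\epsilon$ (independent of $f$) such that $$\int_0^\infty\frac{f(x)}{x^{1+\delta+2\alpha}}\,dx\ \le\ \epsilon\int_0^\infty\frac{f(x)^2}{x^{2+\delta}}\,dx+C_\epsilon\left(1+\|f\|_{L^\infty}\right).$$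
   Context: Here $\mathbb{R}^+=[0,\infty)$, with $C^1$ regularity up to $x=0$. The constants $C_1,C_2$ may depend on $\delta$, and $C_\epsilon$ may depend on $\alpha,\delta,\epsilon$. *)

theory Defs
  imports "HOL-Analysis.Analysis" "HOL-Probability.Essential_Supremum"
begin

text \<open>
  A function on \<open>[0, \<infinity>)\<close> is a function \<open>real \<Rightarrow> real\<close> of which only the values on
  \<open>{0..}\<close> matter. At \<open>0\<close> the derivative is therefore one-sided, which is why
  \<open>C1_differentiable_on\<close> (two-sided derivatives) is not used.
\<close>

definition C1_halfline :: "(real \<Rightarrow> real) \<Rightarrow> bool" where
  "C1_halfline f \<longleftrightarrow>
     (\<exists>f'. (\<forall>x\<in>{0..}. (f has_real_derivative f' x) (at x within {0..})) \<and>
           continuous_on {0..} f')"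

definition Linfty_halfline :: "(real \<Rightarrow> real) \<Rightarrow> bool" where
  "Linfty_halfline f \<longleftrightarrow>
     f \<in> borel_measurable (lebesgue_on {0..}) \<and>
     esssup (lebesgue_on {0..}) (\<lambda>x. ereal \<bar>f x\<bar>) < \<infinity>"

text \<open>Meaningful for \<open>Linfty_halfline\<close> functions only: \<open>real_of_ereal \<infinity> = 0\<close>.\<close>

definition Linfty_norm :: "(real \<Rightarrow> real) \<Rightarrow> real" where
  "Linfty_norm f = real_of_ereal (esssup (lebesgue_on {0..}) (\<lambda>x. ereal \<bar>f x\<bar>))"

end

theory Submission
  imports Defs
begin

text \<open>
  On \<open>(0, 1]\<close>, Young's inequality gives
  \<open>|f| / x\<^bsup>1+\<delta>+s\<^esup> \<le> \<epsilon> f\<^sup>2 / x\<^bsup>2+\<delta>\<^esup> + x\<^bsup>-\<delta>-2s\<^esup> / (4 \<epsilon>)\<close>, where the last term is integrable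
  because \<open>\<delta> + 2 s < 1\<close>; on \<open>(1, \<infinity>)\<close> one uses \<open>|f| \<le> \<parallel>f\<parallel>\<close>. Part (ii) is the case \<open>s = 2 \<alpha>\<close>.
  Part (i) is the case \<open>s = 0\<close> with \<open>\<epsilon> = 1 / (2 (1 - \<delta>) I)\<close>, where \<open>I\<close> is the integral of
  \<open>|f| / x\<^bsup>1+\<delta>\<^esup>\<close>: the term \<open>1 / (4 \<epsilon> (1 - \<delta>)) = I / 2\<close> is then absorbed. All the integrals are
  finite because \<open>f 0 = 0\<close> and the \<open>C\<^sup>1\<close> regularity give \<open>|f x| \<le> K x\<close> near \<open>0\<close>.
\<close>

definition two_power :: "real \<Rightarrow> real \<Rightarrow> real \<Rightarrow> real \<Rightarrow> real \<Rightarrow> real" where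
  "two_power A a B b x = (if x \<le> 1 then A * x powr (-a) else B * x powr (-b))"

lemma two_power_nonneg: "0 \<le> A \<Longrightarrow> 0 \<le> B \<Longrightarrow> 0 \<le> two_power A a B b x"
  by (simp add: two_power_def)

lemma two_power_has_integral:
  assumes "a < 1" "1 < b"
  shows "(two_power A a B b has_integral A / (1 - a) + B / (b - 1)) {0<..}"
proof -
  have "((\<lambda>x. x powr (-a)) has_integral (1 / (1 - a))) {0..1}"
    using has_integral_powr_from_0[of "-a" 1] assms by simp
  then have "((\<lambda>x. A * x powr (-a)) has_integral (A * (1 / (1 - a)))) {0..1}"
    by (rule has_integral_mult_right)
  then have 1: "(two_power A a B b has_integral (A / (1 - a))) {0..1}"
    by (subst has_integral_cong[of _ _ "\<lambda>x. A * x powr (-a)"]) (auto simp: two_power_def)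
  have "- 1 / (- b + 1) = 1 / (b - 1)"
    using assms by (simp add: divide_simps)
  then have "((\<lambda>x. x powr (-b)) has_integral (1 / (b - 1))) {1..}"
    using has_integral_powr_to_inf[of "-b" 1] assms by (simp only: powr_one_eq_one)
  from has_integral_mult_right[OF this, of B]
  have "((\<lambda>x. B * x powr (-b)) has_integral (B / (b - 1))) {1..}"
    by simp
  then have 2: "(two_power A a B b has_integral (B / (b - 1))) {1..}"
    by (rule has_integral_spike[of "{1}", rotated 2])
      (auto simp: two_power_def)
  have "{0..1} \<inter> {1..} = {1::real}" by auto
  then have "(two_power A a B b has_integral (A / (1 - a) + B / (b - 1))) ({0..1} \<union> {1..})"
    by (intro has_integral_Un 1 2) auto
  moreover have "negligible {x \<in> {0..1} \<union> {1..} - {0<..}. two_power A a B b x \<noteq> 0}"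
    by (rule negligible_subset[of "{0}"]) auto
  moreover have "negligible {x \<in> {0<..} - ({0..1} \<union> {1..}). two_power A a B b x \<noteq> 0}"
    by (rule negligible_subset[of "{}"]) auto
  ultimately show ?thesis
    by (rule has_integral_spike_set_eq[THEN iffD1, rotated 2])
qed

lemma two_power_set_integral:
  assumes "a < 1" "1 < b" "0 \<le> A" "0 \<le> B"
  shows "set_integrable lebesgue {0<..} (two_power A a B b)"
    and "(LINT x:{0<..}|lebesgue. two_power A a B b x) = A / (1 - a) + B / (b - 1)"
proof -
  note hi = two_power_has_integral[OF assms(1,2), of A B]
  show si: "set_integrable lebesgue {0<..} (two_power A a B b)"
    using hi by (intro nonnegative_absolutely_integrable_1)
      (auto simp: integrable_on_def assms two_power_nonneg)
  show "(LINT x:{0<..}|lebesgue. two_power A a B b x) = A / (1 - a) + B / (b - 1)"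
    using set_lebesgue_integral_eq_integral(2)[OF si] integral_unique[OF hi] by simp
qed

lemma AE_abs_le_Linfty_norm:
  assumes "Linfty_halfline f"
  shows "AE x\<in>{0<..} in lebesgue. \<bar>f x\<bar> \<le> Linfty_norm f" and "0 \<le> Linfty_norm f"
proof -
  let ?M = "lebesgue_on {0::real..}"
  let ?e = "esssup ?M (\<lambda>x. ereal \<bar>f x\<bar>)"
  have ne: "emeasure ?M (space ?M) \<noteq> 0"
  proof -
    have "emeasure lebesgue {0..1::real} \<le> emeasure lebesgue {0::real..}"
      by (intro emeasure_mono) auto
    then show ?thesis
      by (auto simp: emeasure_restrict_space)
  qed
  have "esssup ?M (\<lambda>x. 0 :: ereal) \<le> ?e"
    by (rule esssup_mono) auto
  then have e0: "0 \<le> ?e"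
    using esssup_const[OF ne, of "0 :: ereal"] by simp
  then have e: "?e = ereal (Linfty_norm f)"
    using assms unfolding Linfty_norm_def Linfty_halfline_def by (cases ?e) auto
  show "0 \<le> Linfty_norm f"
    using e0 unfolding e by simp
  have "AE x in ?M. \<bar>f x\<bar> \<le> Linfty_norm f"
    using esssup_AE[where M = ?M and f = "\<lambda>x. ereal \<bar>f x\<bar>"] unfolding e by simp
  then show "AE x\<in>{0<..} in lebesgue. \<bar>f x\<bar> \<le> Linfty_norm f"
    by (subst (asm) AE_restrict_space_iff) auto
qed

lemma C1_halfline_bound_near_0:
  assumes "C1_halfline f" "f 0 = 0"
  obtains K where "0 \<le> K" "\<And>x. 0 \<le> x \<Longrightarrow> x \<le> 1 \<Longrightarrow> \<bar>f x\<bar> \<le> K * x"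
proof -
  obtain f' where d: "\<And>x. 0 \<le> x \<Longrightarrow> (f has_real_derivative f' x) (at x within {0..})"
    and c: "continuous_on {0..} f'"
    using assms(1) unfolding C1_halfline_def by auto
  have "compact (f' ` {0..1})"
    by (intro compact_continuous_image continuous_on_subset[OF c]) auto
  then obtain K where K: "\<And>x. x \<in> {0..1} \<Longrightarrow> \<bar>f' x\<bar> \<le> K"
    unfolding compact_eq_bounded_closed bounded_iff by (auto simp del: atLeastAtMost_iff)
  have "\<bar>f x\<bar> \<le> K * x" if "0 \<le> x" "x \<le> 1" for x
  proof -
    have "norm (f x - f 0) \<le> K * norm (x - 0)"
    proof (rule field_differentiable_bound[where S = "{0..1}"])
      show "(f has_field_derivative f' z) (at z within {0..1})" if "z \<in> {0..1}" for z
        using d[of z] that by (auto intro: DERIV_subset)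
    qed (use K that in auto)
    then show ?thesis using that assms(2) by simp
  qed
  moreover have "0 \<le> K" using K[of 0] by simp
  ultimately show ?thesis using that by blast
qed

lemma set_integrable_two_power_bound:
  fixes g :: "real \<Rightarrow> real"
  assumes "a < 1" "1 < b" "0 \<le> A" "0 \<le> B"
    and "g \<in> borel_measurable (lebesgue_on {0<..})"
    and "AE x\<in>{0<..} in lebesgue. \<bar>g x\<bar> \<le> two_power A a B b x"
  shows "set_integrable lebesgue {0<..} g"
proof (rule set_integrable_bound[OF two_power_set_integral(1)[OF assms(1-4)]])
  show "set_borel_measurable lebesgue {0<..} g"
    using assms(5) by (simp add: set_borel_measurable_def borel_measurable_restrict_space_iff)
  show "AE x in lebesgue. x \<in> {0<..} \<longrightarrow> norm (g x) \<le> norm (two_power A a B b x)"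
    using assms(6) two_power_nonneg[OF assms(3,4)] by simp
qed

lemma Linfty_halfline_measurable:
  assumes "Linfty_halfline f"
  shows "f \<in> borel_measurable (lebesgue_on {0<..})"
  using assms unfolding Linfty_halfline_def
  by (elim conjE) (erule measurable_restrict_mono, auto)

context
  fixes f :: "real \<Rightarrow> real" and \<delta> :: real
  assumes f: "C1_halfline f" "Linfty_halfline f" "f 0 = 0" and \<delta>: "0 < \<delta>"
begin

lemma set_integrable_weight:
  assumes "0 \<le> s" "\<delta> + s < 1"
  shows "set_integrable lebesgue {0<..} (\<lambda>x. f x / x powr (1 + \<delta> + s))"
proof -
  obtain K where K: "0 \<le> K" "\<And>x. 0 \<le> x \<Longrightarrow> x \<le> 1 \<Longrightarrow> \<bar>f x\<bar> \<le> K * x"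
    using C1_halfline_bound_near_0 f by metis
  note M = AE_abs_le_Linfty_norm[OF f(2)]
  note [measurable] = Linfty_halfline_measurable[OF f(2)]
  have [measurable]: "(\<lambda>x. x) \<in> borel_measurable (lebesgue_on {0::real<..})"
    by (intro continuous_imp_measurable_on_sets_lebesgue continuous_intros) auto
  show ?thesis
  proof (rule set_integrable_two_power_bound[where A = K and B = "Linfty_norm f"])
    show "\<delta> + s < 1" "1 < 1 + \<delta> + s" using assms \<delta> by auto
    show "(\<lambda>x. f x / x powr (1 + \<delta> + s)) \<in> borel_measurable (lebesgue_on {0<..})"
      by measurable
    show "AE x\<in>{0<..} in lebesgue. \<bar>f x / x powr (1 + \<delta> + s)\<bar>
        \<le> two_power K (\<delta> + s) (Linfty_norm f) (1 + \<delta> + s) x"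
      using M(1)
    proof (rule AE_mp, intro AE_I2 impI)
      fix x :: real
      assume le: "x \<in> {0<..} \<longrightarrow> \<bar>f x\<bar> \<le> Linfty_norm f" and x: "x \<in> {0<..}"
      have eq: "\<bar>f x / x powr (1 + \<delta> + s)\<bar> = \<bar>f x\<bar> * x powr (-(1 + \<delta> + s))"
        by (simp only: abs_mult divide_inverse powr_minus[symmetric] abs_of_nonneg powr_ge_zero
          zero_le_power2)
      show "\<bar>f x / x powr (1 + \<delta> + s)\<bar>
          \<le> two_power K (\<delta> + s) (Linfty_norm f) (1 + \<delta> + s) x"
      proof (cases "x \<le> 1")
        case True
        have "\<bar>f x\<bar> * x powr (-(1 + \<delta> + s)) \<le> K * x * x powr (-(1 + \<delta> + s))"
          using K(2)[of x] True x by (intro mult_right_mono) auto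
        also have "\<dots> = K * x powr (-(\<delta> + s))"
          using x powr_add[of x 1 "-(1 + \<delta> + s)"] by simp
        finally show ?thesis
          using True unfolding eq two_power_def by simp
      next
        case False
        have "\<bar>f x\<bar> * x powr (-(1 + \<delta> + s)) \<le> Linfty_norm f * x powr (-(1 + \<delta> + s))"
          using le x by (intro mult_right_mono) auto
        with False show ?thesis
          unfolding eq two_power_def by simp
      qed
    qed
  qed (use K(1) M(2) in simp_all)
qed

lemma set_integrable_square_weight:
  assumes "\<delta> < 1"
  shows "set_integrable lebesgue {0<..} (\<lambda>x. (f x)\<^sup>2 / x powr (2 + \<delta>))"
proof -
  obtain K where K: "0 \<le> K" "\<And>x. 0 \<le> x \<Longrightarrow> x \<le> 1 \<Longrightarrow> \<bar>f x\<bar> \<le> K * x"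
    using C1_halfline_bound_near_0 f by metis
  note M = AE_abs_le_Linfty_norm[OF f(2)]
  note [measurable] = Linfty_halfline_measurable[OF f(2)]
  have [measurable]: "(\<lambda>x. x) \<in> borel_measurable (lebesgue_on {0::real<..})"
    by (intro continuous_imp_measurable_on_sets_lebesgue continuous_intros) auto
  show ?thesis
  proof (rule set_integrable_two_power_bound[where A = "K\<^sup>2" and B = "(Linfty_norm f)\<^sup>2"])
    show "\<delta> < 1" "1 < 2 + \<delta>" using assms \<delta> by auto
    show "(\<lambda>x. (f x)\<^sup>2 / x powr (2 + \<delta>)) \<in> borel_measurable (lebesgue_on {0<..})"
      by measurable
    show "AE x\<in>{0<..} in lebesgue. \<bar>(f x)\<^sup>2 / x powr (2 + \<delta>)\<bar>
        \<le> two_power (K\<^sup>2) \<delta> ((Linfty_norm f)\<^sup>2) (2 + \<delta>) x"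
      using M(1)
    proof (rule AE_mp, intro AE_I2 impI)
      fix x :: real
      assume le: "x \<in> {0<..} \<longrightarrow> \<bar>f x\<bar> \<le> Linfty_norm f" and x: "x \<in> {0<..}"
      have eq: "\<bar>(f x)\<^sup>2 / x powr (2 + \<delta>)\<bar> = (f x)\<^sup>2 * x powr (-(2 + \<delta>))"
        by (simp only: abs_mult divide_inverse powr_minus[symmetric] abs_of_nonneg powr_ge_zero
          zero_le_power2)
      show "\<bar>(f x)\<^sup>2 / x powr (2 + \<delta>)\<bar>
          \<le> two_power (K\<^sup>2) \<delta> ((Linfty_norm f)\<^sup>2) (2 + \<delta>) x"
      proof (cases "x \<le> 1")
        case True
        have "\<bar>f x\<bar> \<le> K * x"
          using K(2)[of x] True x by simp
        from power_mono[OF this, of 2]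
        have "(f x)\<^sup>2 * x powr (-(2 + \<delta>)) \<le> (K * x)\<^sup>2 * x powr (-(2 + \<delta>))"
          by (intro mult_right_mono) simp_all
        also have "\<dots> = K\<^sup>2 * x powr (-\<delta>)"
          using x powr_add[of x 2 "-(2 + \<delta>)"] by (simp add: power_mult_distrib)
        finally show ?thesis
          using True unfolding eq two_power_def by simp
      next
        case False
        have "\<bar>f x\<bar> \<le> Linfty_norm f"
          using le x by simp
        from power_mono[OF this, of 2]
        have "(f x)\<^sup>2 * x powr (-(2 + \<delta>)) \<le> (Linfty_norm f)\<^sup>2 * x powr (-(2 + \<delta>))"
          by (intro mult_right_mono) simp_all
        with False show ?thesis
          unfolding eq two_power_def by simp
      qed
    qed
  qed (use K(1) M(2) in simp_all)
qed

end

lemma weighted_Young: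
  fixes x y \<epsilon> :: real
  assumes "0 < x" "0 < \<epsilon>"
  shows "\<bar>y\<bar> / x powr (1 + \<delta> + s)
    \<le> \<epsilon> * (y\<^sup>2 / x powr (2 + \<delta>)) + 1 / (4 * \<epsilon>) * x powr (-(\<delta> + 2 * s))"
proof -
  define u where "u = \<bar>y\<bar> * x powr (-(1 + \<delta> / 2))"
  define v where "v = x powr (-(\<delta> / 2 + s))"
  have "u * v = \<bar>y\<bar> * x powr (-(1 + \<delta> + s))"
    unfolding u_def v_def mult.assoc powr_add[symmetric] by (simp add: algebra_simps)
  moreover have "u\<^sup>2 = y\<^sup>2 * x powr (-(2 + \<delta>))"
    unfolding u_def power_mult_distrib power2_eq_square[of "_ powr _"] powr_add[symmetric]
    by (simp add: add.commute)
  moreover have "v\<^sup>2 = x powr (-(\<delta> + 2 * s))"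
    unfolding v_def power2_eq_square[of "_ powr _"] powr_add[symmetric]
    by (rule arg_cong[where f = "(powr) x"]) simp
  moreover have "u * v \<le> \<epsilon> * u\<^sup>2 + 1 / (4 * \<epsilon>) * v\<^sup>2"
  proof -
    have "0 \<le> (2 * \<epsilon> * u - v)\<^sup>2 / (4 * \<epsilon>)" using assms by simp
    also have "\<dots> = \<epsilon> * u\<^sup>2 + 1 / (4 * \<epsilon>) * v\<^sup>2 - u * v"
      using assms by (simp add: field_simps power2_eq_square)
    finally show ?thesis by simp
  qed
  ultimately show ?thesis
    by (simp only: divide_inverse powr_minus[symmetric])
qed

lemma set_integral_weight_bound:
  assumes f: "C1_halfline f" "Linfty_halfline f" "f 0 = 0"
    and \<delta>: "0 < \<delta>" and s: "0 \<le> s" "\<delta> + 2 * s < 1" and \<epsilon>: "0 < \<epsilon>"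
  shows "(LINT x:{0<..}|lebesgue. \<bar>f x\<bar> / x powr (1 + \<delta> + s))
    \<le> \<epsilon> * (LINT x:{0<..}|lebesgue. (f x)\<^sup>2 / x powr (2 + \<delta>))
      + (1 / (4 * \<epsilon> * (1 - (\<delta> + 2 * s))) + Linfty_norm f / (\<delta> + s))"
proof -
  let ?T = "two_power (1 / (4 * \<epsilon>)) (\<delta> + 2 * s) (Linfty_norm f) (1 + \<delta> + s)"
  note M = AE_abs_le_Linfty_norm[OF f(2)]
  have J: "set_integrable lebesgue {0<..} (\<lambda>x. \<epsilon> * ((f x)\<^sup>2 / x powr (2 + \<delta>)))"
    using set_integrable_square_weight[OF f \<delta>] s
    by (intro set_integrable_mult_right) auto
  have prem: "\<delta> + 2 * s < 1" "1 < 1 + \<delta> + s" "0 \<le> 1 / (4 * \<epsilon>)"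
    using \<delta> s \<epsilon> by auto
  note T = two_power_set_integral[OF prem M(2)]
  have "set_integrable lebesgue {0<..} (\<lambda>x. \<bar>f x\<bar> / x powr (1 + \<delta> + s))"
    using set_integrable_abs[OF set_integrable_weight[OF f \<delta> s(1)]] s by simp
  then have "(LINT x:{0<..}|lebesgue. \<bar>f x\<bar> / x powr (1 + \<delta> + s))
    \<le> (LINT x:{0<..}|lebesgue. \<epsilon> * ((f x)\<^sup>2 / x powr (2 + \<delta>)) + ?T x)"
  proof (rule set_integral_mono_AE[OF _ set_integral_add(1)[OF J T(1)]])
    show "AE x\<in>{0<..} in lebesgue. \<bar>f x\<bar> / x powr (1 + \<delta> + s)
        \<le> \<epsilon> * ((f x)\<^sup>2 / x powr (2 + \<delta>)) + ?T x"
      using M(1)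
    proof (rule AE_mp, intro AE_I2 impI)
      fix x :: real
      assume le: "x \<in> {0<..} \<longrightarrow> \<bar>f x\<bar> \<le> Linfty_norm f" and x: "x \<in> {0<..}"
      show "\<bar>f x\<bar> / x powr (1 + \<delta> + s) \<le> \<epsilon> * ((f x)\<^sup>2 / x powr (2 + \<delta>)) + ?T x"
      proof (cases "x \<le> 1")
        case True
        then show ?thesis
          using weighted_Young[of x \<epsilon> "f x" \<delta> s] x \<epsilon> by (simp add: two_power_def)
      next
        case False
        have "\<bar>f x\<bar> / x powr (1 + \<delta> + s) \<le> Linfty_norm f / x powr (1 + \<delta> + s)"
          using le x by (intro divide_right_mono) auto
        also have "\<dots> = ?T x"
          using False by (simp only: two_power_def divide_inverse powr_minus[symmetric] if_False)
        also have "\<dots> \<le> \<epsilon> * ((f x)\<^sup>2 / x powr (2 + \<delta>)) + ?T x"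
          using \<epsilon> by simp
        finally show ?thesis .
      qed
    qed
  qed
  also have "\<dots> = \<epsilon> * (LINT x:{0<..}|lebesgue. (f x)\<^sup>2 / x powr (2 + \<delta>))
      + (1 / (4 * \<epsilon> * (1 - (\<delta> + 2 * s))) + Linfty_norm f / (\<delta> + s))"
    unfolding set_integral_add(2)[OF J T(1)] T(2) set_integral_mult_right by simp
  finally show ?thesis .
qed

lemma square_weight_lower_bound:
  assumes f: "C1_halfline f" "Linfty_halfline f" "f 0 = 0" and \<delta>: "0 < \<delta>" "\<delta> < 1"
  shows "(1 - \<delta>) / 2 * (LINT x:{0<..}|lebesgue. \<bar>f x\<bar> / x powr (1 + \<delta>))\<^sup>2
      - 2 * (1 - \<delta>) / \<delta>\<^sup>2 * (1 + (Linfty_norm f)\<^sup>2)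
    \<le> (LINT x:{0<..}|lebesgue. (f x)\<^sup>2 / x powr (2 + \<delta>))" (is "?c * ?I\<^sup>2 - _ \<le> ?J")
proof -
  define I where "I = ?I"
  define J where "J = ?J"
  define m where "m = Linfty_norm f / \<delta>"
  have I: "0 \<le> I" and J: "0 \<le> J"
    unfolding I_def J_def by (auto simp: set_lebesgue_integral_def intro!: integral_nonneg_AE)
  have "?c * I\<^sup>2 \<le> J + 2 * (1 - \<delta>) * m\<^sup>2"
  proof (cases "I = 0")
    case True
    then show ?thesis using J \<delta> by simp
  next
    case False
    with I have I: "0 < I" by simp
    define \<epsilon> where "\<epsilon> = 1 / (2 * (1 - \<delta>) * I)"
    have "0 < \<epsilon>" using I \<delta> by (simp add: \<epsilon>_def)
    then have "I \<le> \<epsilon> * J + (1 / (4 * \<epsilon> * (1 - \<delta>)) + m)"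
      using set_integral_weight_bound[OF f \<delta>(1), of 0 \<epsilon>] \<delta> by (simp add: I_def J_def m_def)
    moreover have "1 / (4 * \<epsilon> * (1 - \<delta>)) = I / 2"
      using I \<delta> by (simp add: \<epsilon>_def field_simps)
    ultimately have "2 * (1 - \<delta>) * I * (I / 2) \<le> 2 * (1 - \<delta>) * I * (\<epsilon> * J + m)"
      using I \<delta> by (intro mult_left_mono) auto
    also have "\<dots> = J + 2 * (1 - \<delta>) * (I * m)"
      using I \<delta> by (simp add: \<epsilon>_def field_simps)
    also have "\<dots> \<le> J + 2 * (1 - \<delta>) * (I\<^sup>2 / 4 + m\<^sup>2)"
      using zero_le_power2[of "I / 2 - m"] \<delta>
      by (intro add_left_mono mult_left_mono) (auto simp: power2_eq_square algebra_simps)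
    also have "\<dots> = J + ?c * I\<^sup>2 + 2 * (1 - \<delta>) * m\<^sup>2"
      by (simp add: field_simps)
    also have "2 * (1 - \<delta>) * I * (I / 2) = 2 * (?c * I\<^sup>2)"
      by (simp add: power2_eq_square)
    finally show ?thesis
      by linarith
  qed
  moreover have "2 * (1 - \<delta>) * m\<^sup>2 \<le> 2 * (1 - \<delta>) / \<delta>\<^sup>2 * (1 + (Linfty_norm f)\<^sup>2)"
    using \<delta> by (simp add: m_def power_divide field_simps)
  ultimately show ?thesis
    unfolding I_def J_def by simp
qed

lemma weight_upper_bound:
  assumes f: "C1_halfline f" "Linfty_halfline f" "f 0 = 0"
    and \<alpha>: "0 < \<alpha>" and \<delta>: "0 < \<delta>" "\<delta> < 1 - 4 * \<alpha>" and \<epsilon>: "0 < \<epsilon>"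
  shows "(LINT x:{0<..}|lebesgue. f x / x powr (1 + \<delta> + 2 * \<alpha>))
    \<le> \<epsilon> * (LINT x:{0<..}|lebesgue. (f x)\<^sup>2 / x powr (2 + \<delta>))
      + (1 / (4 * \<epsilon> * (1 - (\<delta> + 4 * \<alpha>))) + 1 / (\<delta> + 2 * \<alpha>)) * (1 + Linfty_norm f)"
proof -
  note N = AE_abs_le_Linfty_norm(2)[OF f(2)]
  have int: "set_integrable lebesgue {0<..} (\<lambda>x. f x / x powr (1 + \<delta> + 2 * \<alpha>))"
    using set_integrable_weight[OF f \<delta>(1)] \<alpha> \<delta> by simp
  have "(LINT x:{0<..}|lebesgue. f x / x powr (1 + \<delta> + 2 * \<alpha>))
    \<le> (LINT x:{0<..}|lebesgue. \<bar>f x\<bar> / x powr (1 + \<delta> + 2 * \<alpha>))"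
    using set_integrable_abs[OF int]
    by (intro set_integral_mono int) (auto intro: divide_right_mono)
  also have "\<dots> \<le> \<epsilon> * (LINT x:{0<..}|lebesgue. (f x)\<^sup>2 / x powr (2 + \<delta>))
      + (1 / (4 * \<epsilon> * (1 - (\<delta> + 4 * \<alpha>))) + Linfty_norm f / (\<delta> + 2 * \<alpha>))"
    using set_integral_weight_bound[OF f \<delta>(1), of "2 * \<alpha>" \<epsilon>] \<alpha> \<delta> \<epsilon> by simp
  also have "1 / (4 * \<epsilon> * (1 - (\<delta> + 4 * \<alpha>))) + Linfty_norm f / (\<delta> + 2 * \<alpha>)
      \<le> (1 / (4 * \<epsilon> * (1 - (\<delta> + 4 * \<alpha>))) + 1 / (\<delta> + 2 * \<alpha>)) * (1 + Linfty_norm f)"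
  proof -
    have "0 \<le> 1 / (4 * \<epsilon> * (1 - (\<delta> + 4 * \<alpha>)))" "0 \<le> 1 / (\<delta> + 2 * \<alpha>)"
      using \<alpha> \<delta> \<epsilon> by auto
    moreover have "p + n * q \<le> (p + q) * (1 + n)" if "0 \<le> p" "0 \<le> q" "0 \<le> n" for p q n :: real
      using that mult_nonneg_nonneg[of p n] by (simp add: algebra_simps)
    ultimately show ?thesis
      using N by (metis mult.right_neutral times_divide_eq_right)
  qed
  finally show ?thesis by simp
qed

theorem lemma6p2:
  shows "(\<forall>\<delta>::real. 0 < \<delta> \<and> \<delta> < 1 \<longrightarrow>
            (\<exists>C1 C2 :: real. C1 > 0 \<and> C2 > 0 \<and>
              (\<forall>f :: real \<Rightarrow> real.
                 C1_halfline f \<and> Linfty_halfline f \<and> f 0 = 0 \<longrightarrow>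
                 (LINT x:{0<..}|lebesgue. (f x)\<^sup>2 / x powr (2 + \<delta>))
                   \<ge> C1 * (LINT x:{0<..}|lebesgue. \<bar>f x\<bar> / x powr (1 + \<delta>))\<^sup>2
                       - C2 * (1 + (Linfty_norm f)\<^sup>2)))) \<and>
         (\<forall>\<alpha> \<delta> \<epsilon> :: real.
            0 < \<alpha> \<and> \<alpha> < 1 / 4 \<and> 0 < \<delta> \<and> \<delta> < 1 - 4 * \<alpha> \<and> \<epsilon> > 0 \<longrightarrow>
            (\<exists>C :: real.
              (\<forall>f :: real \<Rightarrow> real.
                 C1_halfline f \<and> Linfty_halfline f \<and> f 0 = 0 \<longrightarrow>
                 (LINT x:{0<..}|lebesgue. f x / x powr (1 + \<delta> + 2 * \<alpha>))
                   \<le> \<epsilon> * (LINT x:{0<..}|lebesgue. (f x)\<^sup>2 / x powr (2 + \<delta>))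
                       + C * (1 + Linfty_norm f))))"
proof (intro conjI allI impI)
  fix \<delta> :: real
  assume \<delta>: "0 < \<delta> \<and> \<delta> < 1"
  show "\<exists>C1 C2 :: real. C1 > 0 \<and> C2 > 0 \<and>
      (\<forall>f. C1_halfline f \<and> Linfty_halfline f \<and> f 0 = 0 \<longrightarrow>
        (LINT x:{0<..}|lebesgue. (f x)\<^sup>2 / x powr (2 + \<delta>))
          \<ge> C1 * (LINT x:{0<..}|lebesgue. \<bar>f x\<bar> / x powr (1 + \<delta>))\<^sup>2
              - C2 * (1 + (Linfty_norm f)\<^sup>2))"
  proof (rule exI[of _ "(1 - \<delta>) / 2"], rule exI[of _ "2 * (1 - \<delta>) / \<delta>\<^sup>2"],
      intro conjI allI impI)
    show "0 < (1 - \<delta>) / 2" "0 < 2 * (1 - \<delta>) / \<delta>\<^sup>2" using \<delta> by auto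
  next
    fix f assume "C1_halfline f \<and> Linfty_halfline f \<and> f 0 = 0"
    then show "(1 - \<delta>) / 2 * (LINT x:{0<..}|lebesgue. \<bar>f x\<bar> / x powr (1 + \<delta>))\<^sup>2
          - 2 * (1 - \<delta>) / \<delta>\<^sup>2 * (1 + (Linfty_norm f)\<^sup>2)
        \<le> (LINT x:{0<..}|lebesgue. (f x)\<^sup>2 / x powr (2 + \<delta>))"
      using \<delta> by (elim conjE) (rule square_weight_lower_bound)
  qed
next
  fix \<alpha> \<delta> \<epsilon> :: real
  assume "0 < \<alpha> \<and> \<alpha> < 1 / 4 \<and> 0 < \<delta> \<and> \<delta> < 1 - 4 * \<alpha> \<and> \<epsilon> > 0"
  then show "\<exists>C. \<forall>f. C1_halfline f \<and> Linfty_halfline f \<and> f 0 = 0 \<longrightarrow>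
      (LINT x:{0<..}|lebesgue. f x / x powr (1 + \<delta> + 2 * \<alpha>))
        \<le> \<epsilon> * (LINT x:{0<..}|lebesgue. (f x)\<^sup>2 / x powr (2 + \<delta>)) + C * (1 + Linfty_norm f)"
    by (intro exI allI impI, elim conjE) (rule weight_upper_bound)
qed

end
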